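(* Let $\mathcal{M}=\{M^{(\lambda)}:\lambda>0\}$ be standard log-convex and put $m^{(\lambda)}_j:=M^{(\lambda)}_j/j!$. Then: (Roumieu case) $\mathcal{F}_{\{\mathcal{M}\}}$ is closed under the pointwise product $\odot$ if and only if $$\forall\,\lambda>0\ \exists\,\kappa>0\ \exists\,C,h>0\ \forall\,j\in\mathbb{N}:\quad (m^{(\lambda)}_j)^2\le Ch^jm^{(\kappa)}_j.$$ (Beurling case) $\mathcal{F}_{(\mathcal{M})}$ is a ring under $\odot$ (i.e. is closed under $\odot$) if and only if $$\forall\,\lambda>0\ \exists\,\kappa>0\ \exists\,C,h>0\ \forall\,j\in\mathbb{N}:\quad (m^{(\kappa)}_j)^2\le Ch^jm^{(\lambda)}_j.$$
   Context: $\mathbb{N}=\{0,1,2,\dots\}$. A sequence $M=(M_j)_{j\in\mathbb{N}}$ of positive reals is normalized if $1=M_0\le M_1$ and log-convex if $M_j^2\le M_{j-1}M_{j+1}$ for all $j\ge1$. $\mathcal{LC}$ is the set of normalized log-convex sequences of positive reals with $\lim_{k\to+\infty}(M_k)^{1/k}=+\infty$. A family $\mathcal{M}=\{M^{(\lambda)}:\lambda>0\}$ (indexed by positive reals) is standard log-convex if $M^{(\lambda)}\in\mathcal{LC}$ for all $\lambda>0$ and $M^{(\lambda)}_j\le M^{(\kappa)}_j$ for all $j$ whenever $0<\lambda\le\kappa$. $\mathcal{F}_{\{\mathcal{M}\}}$, resp. $\mathcal{F}_{(\mathcal{M})}$, is the space of formal power series $\mathbf{F}=\sum_{j\ge0}F_jx^j$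 with complex coefficients such that for some $\lambda>0$ and some $h>0$, resp. for all $\lambda>0$ and all $h>0$, $\sup_{j}\frac{|F_j|}{h^jm^{(\lambda)}_j}<+\infty$. Addition is coefficientwise. The pointwise (Hadamard) product is $\mathbf{F}\odot\mathbf{G}=\sum_{j\ge0}F_jG_jx^j$. Rings are not required to be unital. *)

theory Defs
  imports
    Complex_Main
    "HOL-Computational_Algebra.Formal_Power_Series"
    "HOL-Algebra.Group"
begin

definition normalized_seq :: "(nat \<Rightarrow> real) \<Rightarrow> bool" where
  "normalized_seq M \<longleftrightarrow> M 0 = 1 \<and> 1 \<le> M 1"

definition log_convex_seq :: "(nat \<Rightarrow> real) \<Rightarrow> bool" where
  "log_convex_seq M \<longleftrightarrow> (\<forall>j\<ge>1. (M j)\<^sup>2 \<le> M (j - 1) * M (j + 1))"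

definition LC :: "(nat \<Rightarrow> real) set" where
  "LC = {M. (\<forall>j. 0 < M j) \<and> normalized_seq M \<and> log_convex_seq M \<and>
            filterlim (\<lambda>k. root k (M k)) at_top sequentially}"

text \<open>A family indexed by the positive reals is a function on all reals of which only the
  values at positive arguments matter.\<close>

definition standard_log_convex :: "(real \<Rightarrow> nat \<Rightarrow> real) \<Rightarrow> bool" where
  "standard_log_convex M \<longleftrightarrow>
     (\<forall>\<mu>>0. M \<mu> \<in> LC) \<and>
     (\<forall>\<mu> \<kappa>. 0 < \<mu> \<and> \<mu> \<le> \<kappa> \<longrightarrow> (\<forall>j. M \<mu> j \<le> M \<kappa> j))"

definition over_fact :: "(nat \<Rightarrow> real) \<Rightarrow> nat \<Rightarrow> real" where
  "over_fact M j = M j / fact j"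

definition fps_roumieu :: "(real \<Rightarrow> nat \<Rightarrow> real) \<Rightarrow> complex fps set" where
  "fps_roumieu M =
     {F. \<exists>\<mu>>0. \<exists>h>0. bdd_above (range (\<lambda>j. norm (fps_nth F j) / (h ^ j * over_fact (M \<mu>) j)))}"

definition fps_beurling :: "(real \<Rightarrow> nat \<Rightarrow> real) \<Rightarrow> complex fps set" where
  "fps_beurling M =
     {F. \<forall>\<mu>>0. \<forall>h>0. bdd_above (range (\<lambda>j. norm (fps_nth F j) / (h ^ j * over_fact (M \<mu>) j)))}"

definition fps_hadamard :: "complex fps \<Rightarrow> complex fps \<Rightarrow> complex fps" where
  "fps_hadamard F G = Abs_fps (\<lambda>j. fps_nth F j * fps_nth G j)"

definition closed_under :: "('a \<Rightarrow> 'a \<Rightarrow> 'a) \<Rightarrow> 'a set \<Rightarrow> bool" where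
  "closed_under f S \<longleftrightarrow> (\<forall>x\<in>S. \<forall>y\<in>S. f x y \<in> S)"

text \<open>Rings are not required to have a unit, so the locale \<open>ring\<close> of HOL-Algebra does not apply.
  The addition is that of the ambient type, the multiplication is a parameter.\<close>

definition nonunital_ring_on :: "('a::ab_group_add \<Rightarrow> 'a \<Rightarrow> 'a) \<Rightarrow> 'a set \<Rightarrow> bool" where
  "nonunital_ring_on f S \<longleftrightarrow>
     comm_group \<lparr>carrier = S, monoid.mult = (+), one = 0\<rparr> \<and>
     closed_under f S \<and>
     (\<forall>x\<in>S. \<forall>y\<in>S. \<forall>z\<in>S. f (f x y) z = f x (f y z)) \<and>
     (\<forall>x\<in>S. \<forall>y\<in>S. \<forall>z\<in>S. f (x + y) z = f x z + f y z \<and> f x (y + z) = f x y + f x z)"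

end

theory Submission
  imports Defs
begin

text \<open>In the Roumieu case the weight \<open>m\<^sup>(\<^sup>\<mu>\<^sup>)\<close> is itself the coefficient sequence of an element of
  the space, and its Hadamard square gives the condition. In the Beurling case, if the condition
  fails at \<open>\<mu>\<close>, there are indices \<open>s 0 < s 1 < \<dots>\<close> with
  \<open>(m\<^sup>(\<^sup>\<kappa>\<^sup>)\<^sub>j)\<^sup>2 > (n + 1) (n + 1)\<^sup>j m\<^sup>(\<^sup>\<mu>\<^sup>)\<^sub>j\<close> for \<open>j = s n\<close>, \<open>\<kappa> = 1 / (n + 1)\<close>. The lacunary series with
  coefficients \<open>m\<^sup>(\<^sup>\<kappa>\<^sup>)\<^sub>j (n + 1)\<^bsup>-j/2\<^esup>\<close> at \<open>j = s n\<close> lies in the Beurling space, but its Hadamard square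
  does not.\<close>

section \<open>Membership in the two spaces as coefficient bounds\<close>

lemma bdd_above_weighted_iff:
  fixes F :: "complex fps"
  assumes "\<And>j. 0 < w j" "0 < h"
  shows "bdd_above (range (\<lambda>j. norm (fps_nth F j) / (h ^ j * w j))) \<longleftrightarrow>
    (\<exists>C>0. \<forall>j. norm (fps_nth F j) \<le> C * h ^ j * w j)" (is "?L \<longleftrightarrow> ?R")
proof -
  have pos: "0 < h ^ j * w j" for j
    using assms by simp
  show ?thesis
  proof
    assume ?L
    then obtain B where B: "norm (fps_nth F j) / (h ^ j * w j) \<le> B" for j
      unfolding bdd_above_def by auto
    \<comment> \<open>\<open>B\<close> can be 0 when all coefficients vanish; \<open>max B 1\<close>
      keeps the constant positive, so that sums and products of such constants are again
      admissible.\<close>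
    have "norm (fps_nth F j) \<le> max B 1 * h ^ j * w j" for j
    proof -
      have "norm (fps_nth F j) / (h ^ j * w j) \<le> max B 1"
        using B[of j] by simp
      then show ?thesis
        using pos[of j] by (simp add: pos_divide_le_eq mult.assoc)
    qed
    then show ?R
      by (intro exI[of _ "max B 1"]) auto
  next
    assume ?R
    then obtain C where C: "norm (fps_nth F j) \<le> C * h ^ j * w j" for j
      by blast
    show ?L
    proof (rule bdd_aboveI2)
      show "norm (fps_nth F j) / (h ^ j * w j) \<le> C" for j
        using C[of j] pos[of j] by (simp add: pos_divide_le_eq mult.assoc)
    qed
  qed
qed

lemma over_fact_pos: "\<lbrakk>standard_log_convex M; 0 < \<mu>\<rbrakk> \<Longrightarrow> 0 < over_fact (M \<mu>) j"
  by (auto simp: standard_log_convex_def LC_def over_fact_def)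

lemma over_fact_mono:
  "\<lbrakk>standard_log_convex M; 0 < \<mu>; \<mu> \<le> \<kappa>\<rbrakk> \<Longrightarrow> over_fact (M \<mu>) j \<le> over_fact (M \<kappa>) j"
  by (auto simp: standard_log_convex_def over_fact_def intro!: divide_right_mono)

lemma mem_fps_roumieu_iff:
  assumes "standard_log_convex M"
  shows "F \<in> fps_roumieu M \<longleftrightarrow>
    (\<exists>\<mu>>0. \<exists>h>0. \<exists>C>0. \<forall>j. norm (fps_nth F j) \<le> C * h ^ j * over_fact (M \<mu>) j)"
  unfolding fps_roumieu_def
  by (simp add: bdd_above_weighted_iff over_fact_pos[OF assms] cong: conj_cong)

lemma mem_fps_beurling_iff:
  assumes "standard_log_convex M"
  shows "F \<in> fps_beurling M \<longleftrightarrow>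
    (\<forall>\<mu>>0. \<forall>h>0. \<exists>C>0. \<forall>j. norm (fps_nth F j) \<le> C * h ^ j * over_fact (M \<mu>) j)"
  unfolding fps_beurling_def
  by (simp add: bdd_above_weighted_iff over_fact_pos[OF assms] cong: conj_cong)

text \<open>The estimate behind sufficiency in both cases: once both factors are measured against
  the same weight \<open>x\<close>, their product involves \<open>x\<^sup>2\<close>, which the
  growth condition trades for \<open>y\<close>. The constants and the geometric rates
  multiply.\<close>

lemma norm_mult_le_weighted_square:
  fixes a b :: complex
  assumes "norm a \<le> A * g ^ j * x" "norm b \<le> B * h ^ j * x"
    and "x\<^sup>2 \<le> C * k ^ j * y" "0 < A" "0 < B" "0 < g" "0 < h" "0 < x"
  shows "norm (a * b) \<le> (A * B * C) * (g * h * k) ^ j * y"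
proof -
  have "norm (a * b) \<le> (A * g ^ j * x) * (B * h ^ j * x)"
    unfolding norm_mult using assms by (intro mult_mono) auto
  also have "\<dots> = (A * B * (g ^ j * h ^ j)) * x\<^sup>2"
    by (simp add: power2_eq_square)
  also have "\<dots> \<le> (A * B * (g ^ j * h ^ j)) * (C * k ^ j * y)"
    using assms by (intro mult_left_mono) auto
  also have "\<dots> = (A * B * C) * (g * h * k) ^ j * y"
    by (simp add: power_mult_distrib)
  finally show ?thesis .
qed

section \<open>The Roumieu case\<close>

lemma closed_under_hadamard_roumieu_iff:
  assumes M: "standard_log_convex M"
  shows "closed_under fps_hadamard (fps_roumieu M) \<longleftrightarrow>
    (\<forall>\<mu>>0. \<exists>\<kappa>>0. \<exists>C>0. \<exists>h>0. \<forall>j. (over_fact (M \<mu>) j)\<^sup>2 \<le> C * h ^ j * over_fact (M \<kappa>) j)"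
    (is "?L \<longleftrightarrow> ?R")
proof
  assume L: ?L
  show ?R
  proof (intro allI impI)
    fix \<mu> :: real assume \<mu>: "0 < \<mu>"
    define F where "F = Abs_fps (\<lambda>j. complex_of_real (over_fact (M \<mu>) j))"
    have "F \<in> fps_roumieu M"
      unfolding mem_fps_roumieu_iff[OF M]
      by (rule exI[of _ \<mu>], simp add: \<mu>, rule exI[of _ 1], simp, rule exI[of _ 1])
        (simp add: F_def less_imp_le[OF over_fact_pos[OF M \<mu>]])
    then have "fps_hadamard F F \<in> fps_roumieu M"
      using L by (simp add: closed_under_def)
    moreover have "norm (fps_nth (fps_hadamard F F) j) = (over_fact (M \<mu>) j)\<^sup>2" for j
      by (simp add: fps_hadamard_def F_def norm_mult power2_eq_square)
    ultimately show "\<exists>\<kappa>>0. \<exists>C>0. \<exists>h>0. \<forall>j. (over_fact (M \<mu>) j)\<^sup>2 \<le> C * h ^ j * over_fact (M \<kappa>) j"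
      unfolding mem_fps_roumieu_iff[OF M] by auto
  qed
next
  assume R: ?R
  show ?L
    unfolding closed_under_def
  proof (intro ballI)
    fix F G assume "F \<in> fps_roumieu M" "G \<in> fps_roumieu M"
    then obtain \<mu> g A \<nu> h B where pos: "0 < \<mu>" "0 < g" "0 < A" "0 < \<nu>" "0 < h" "0 < B"
      and F: "\<And>j. norm (fps_nth F j) \<le> A * g ^ j * over_fact (M \<mu>) j"
      and G: "\<And>j. norm (fps_nth G j) \<le> B * h ^ j * over_fact (M \<nu>) j"
      unfolding mem_fps_roumieu_iff[OF M] by blast
    \<comment> \<open>The two factors may be controlled by different weights. Since the weights
      increase with the index, both bounds pass to the larger one, and the growth condition is
      applied there.\<close>
    define \<rho> where "\<rho> = max \<mu> \<nu>"
    have \<rho>: "0 < \<rho>" "\<mu> \<le> \<rho>" "\<nu> \<le> \<rho>"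
      using pos by (auto simp: \<rho>_def)
    have F': "norm (fps_nth F j) \<le> A * g ^ j * over_fact (M \<rho>) j" for j
      by (rule order_trans[OF F]) (use pos \<rho> over_fact_mono[OF M] in \<open>auto intro!: mult_left_mono\<close>)
    have G': "norm (fps_nth G j) \<le> B * h ^ j * over_fact (M \<rho>) j" for j
      by (rule order_trans[OF G]) (use pos \<rho> over_fact_mono[OF M] in \<open>auto intro!: mult_left_mono\<close>)
    obtain \<kappa> C k where \<kappa>: "0 < \<kappa>" "0 < C" "0 < k"
      and sq: "\<And>j. (over_fact (M \<rho>) j)\<^sup>2 \<le> C * k ^ j * over_fact (M \<kappa>) j"
      using R \<rho>(1) by blast
    have "norm (fps_nth (fps_hadamard F G) j) \<le> (A * B * C) * (g * h * k) ^ j * over_fact (M \<kappa>) j" for j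
      using norm_mult_le_weighted_square[OF F' G' sq] pos over_fact_pos[OF M \<rho>(1)]
      by (simp add: fps_hadamard_def)
    moreover have "0 < A * B * C" "0 < g * h * k"
      using pos \<kappa> by simp_all
    ultimately show "fps_hadamard F G \<in> fps_roumieu M"
      unfolding mem_fps_roumieu_iff[OF M] using \<kappa>(1) by blast
  qed
qed

section \<open>The Beurling case\<close>

text \<open>If the bound with the given \<open>c\<close> and \<open>h\<close> held from
  \<open>N\<close> on, the finitely many earlier ratios could be absorbed into the constant, giving
  the excluded global bound. Violations at arbitrarily large \<open>j\<close> are what permits a
  strictly increasing choice of indices later.\<close>

lemma frequently_gt_weighted:
  fixes u v :: "nat \<Rightarrow> real"
  assumes "\<And>j. 0 < v j" "\<And>j. 0 \<le> u j" "0 < c" "0 < h"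
    and "\<not> (\<exists>C>0. \<exists>h>0. \<forall>j. u j \<le> C * h ^ j * v j)"
  shows "\<exists>j\<ge>N. c * h ^ j * v j < u j"
proof (rule ccontr)
  assume "\<not> ?thesis"
  then have tail: "u j \<le> c * h ^ j * v j" if "N \<le> j" for j
    using that by force
  define q where "q j = u j / (h ^ j * v j)" for j
  have q: "0 \<le> q j" "u j = q j * (h ^ j * v j)" for j
    using assms(1)[of j] assms(2)[of j] \<open>0 < h\<close> by (auto simp: q_def)
  define C where "C = c + sum q {..<N}"
  have S: "0 \<le> sum q {..<N}"
    by (simp add: q sum_nonneg)
  have "u j \<le> C * h ^ j * v j" for j
  proof (cases "j < N")
    case True
    then have "q j \<le> sum q {..<N}"
      by (intro member_le_sum) (auto simp: q)
    then have "q j \<le> C"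
      using \<open>0 < c\<close> by (simp add: C_def)
    then show ?thesis
      using assms(1)[of j] \<open>0 < h\<close> by (simp add: q(2) mult.assoc)
  next
    case False
    have "c * (h ^ j * v j) \<le> C * (h ^ j * v j)"
      using S assms(1)[of j] \<open>0 < h\<close> by (intro mult_right_mono) (auto simp: C_def)
    then show ?thesis
      using tail[of j] False by (simp add: mult.assoc)
  qed
  moreover have "0 < C"
    using S \<open>0 < c\<close> by (simp add: C_def)
  ultimately show False
    using assms(4,5) by blast
qed

text \<open>Along \<open>s\<close>, the index 1/(n+1) and the rate 1/sqrt(n+1) both tend to 0, so
  they eventually drop below any prescribed \<mu> and \<open>h\<close>. Only finitely many
  coefficients escape this comparison.\<close>

lemma lacunary_mem_beurling:
  assumes M: "standard_log_convex M" and s: "strict_mono s"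
    and at: "\<And>n. norm (fps_nth F (s n)) =
      over_fact (M (inverse (real (Suc n)))) (s n) / sqrt (real (Suc n)) ^ s n"
    and off: "\<And>j. j \<notin> range s \<Longrightarrow> fps_nth F j = 0"
  shows "F \<in> fps_beurling M"
  unfolding mem_fps_beurling_iff[OF M]
proof (intro allI impI)
  fix \<mu> h :: real assume pos: "0 < \<mu>" "0 < h"
  let ?r = "\<lambda>j. norm (fps_nth F j) / (h ^ j * over_fact (M \<mu>) j)"
  \<comment> \<open>Chosen so that n \<ge> m gives both 1/(n+1) \<le> \<mu> and 1/sqrt(n+1) \<le> h;
    the square root accounts for \<open>h\<^sup>2\<close>.\<close>
  obtain m where m: "max (inverse \<mu>) (inverse (h\<^sup>2)) < real m"
    using reals_Archimedean2 by blast
  have le: "norm (fps_nth F (s n)) \<le> h ^ s n * over_fact (M \<mu>) (s n)" if "m \<le> n" for n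
  proof -
    have n: "inverse \<mu> \<le> real (Suc n)" "inverse (h\<^sup>2) \<le> real (Suc n)"
      using m that by auto
    have "inverse (real (Suc n)) \<le> \<mu>"
      using n(1) pos by (metis inverse_inverse_eq le_imp_inverse_le inverse_positive_iff_positive)
    then have w: "over_fact (M (inverse (real (Suc n)))) (s n) \<le> over_fact (M \<mu>) (s n)"
      by (intro over_fact_mono[OF M]) auto
    have "inverse h = sqrt (inverse (h\<^sup>2))"
      using pos by (simp add: real_sqrt_inverse)
    also have "\<dots> \<le> sqrt (real (Suc n))"
      using n(2) by (rule real_sqrt_le_mono)
    finally have "inverse (sqrt (real (Suc n))) \<le> h"
      using pos by (metis inverse_inverse_eq le_imp_inverse_le inverse_positive_iff_positive)
    then have h: "inverse (sqrt (real (Suc n))) ^ s n \<le> h ^ s n"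
      by (intro power_mono) auto
    have "norm (fps_nth F (s n)) =
        inverse (sqrt (real (Suc n))) ^ s n * over_fact (M (inverse (real (Suc n)))) (s n)"
      unfolding at by (simp add: divide_inverse power_inverse)
    also have "\<dots> \<le> h ^ s n * over_fact (M \<mu>) (s n)"
      using h w pos less_imp_le[OF over_fact_pos[OF M]] by (intro mult_mono) auto
    finally show ?thesis .
  qed
  have wpos: "0 < h ^ j * over_fact (M \<mu>) j" for j
    using pos over_fact_pos[OF M] by simp
  \<comment> \<open>The 1 covers the tail, where the coefficient obeys \<open>le\<close> or vanishes
    off the range of \<open>s\<close>; the sum covers the finite initial segment.\<close>
  have "?r j \<le> 1 + sum ?r {..<s m}" for j
  proof (cases "j < s m")
    case True
    then have "?r j \<le> sum ?r {..<s m}"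
      using less_imp_le[OF wpos] by (intro member_le_sum) auto
    then show ?thesis by simp
  next
    case False
    have "norm (fps_nth F j) \<le> h ^ j * over_fact (M \<mu>) j"
    proof (cases "j \<in> range s")
      case True
      then obtain n where "j = s n" by blast
      with False s have "m \<le> n"
        by (simp add: strict_mono_less)
      with le \<open>j = s n\<close> show ?thesis by blast
    next
      case False
      then show ?thesis using off less_imp_le[OF wpos] by simp
    qed
    then have "?r j \<le> 1"
      using wpos[of j] by (simp add: pos_divide_le_eq)
    moreover have "0 \<le> sum ?r {..<s m}"
      using less_imp_le[OF wpos] by (intro sum_nonneg) auto
    ultimately show ?thesis by linarith
  qed
  then have "bdd_above (range ?r)"
    by (rule bdd_aboveI2)
  then show "\<exists>C>0. \<forall>j. norm (fps_nth F j) \<le> C * h ^ j * over_fact (M \<mu>) j"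
    using bdd_above_weighted_iff over_fact_pos[OF M] pos by simp
qed

lemma closed_under_hadamard_beurling_iff:
  assumes M: "standard_log_convex M"
  shows "closed_under fps_hadamard (fps_beurling M) \<longleftrightarrow>
    (\<forall>\<mu>>0. \<exists>\<kappa>>0. \<exists>C>0. \<exists>h>0. \<forall>j. (over_fact (M \<kappa>) j)\<^sup>2 \<le> C * h ^ j * over_fact (M \<mu>) j)"
    (is "?L \<longleftrightarrow> ?R")
proof
  assume L: ?L
  show ?R
  proof (rule ccontr)
    assume "\<not> ?R"
    then obtain \<mu> where \<mu>: "0 < \<mu>" and neg: "\<And>\<kappa>. 0 < \<kappa> \<Longrightarrow>
        \<not> (\<exists>C>0. \<exists>h>0. \<forall>j. (over_fact (M \<kappa>) j)\<^sup>2 \<le> C * h ^ j * over_fact (M \<mu>) j)"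
      by blast
    define w where "w n = over_fact (M (inverse (real (Suc n))))" for n
    \<comment> \<open>Constant and rate both grow with \<open>n\<close>. The growing rate leaves
      room for dividing by sqrt(n+1)^j, which yields membership; the growing constant survives
      squaring and rules out the bound at \<mu>.\<close>
    have large: "\<exists>j\<ge>N. real (Suc n) * real (Suc n) ^ j * over_fact (M \<mu>) j < (w n j)\<^sup>2" for n N
      unfolding w_def
      by (rule frequently_gt_weighted[OF over_fact_pos[OF M \<mu>] _ _ _ neg]) auto
    have "\<exists>s. \<forall>n. real (Suc n) * real (Suc n) ^ s n * over_fact (M \<mu>) (s n) < (w n (s n))\<^sup>2
        \<and> s n < s (Suc n)"
      by (rule dependent_nat_choice) (use large in \<open>auto simp: Suc_le_eq[symmetric] simp del: of_nat_Suc\<close>)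
    then obtain s where
      big: "\<And>n. real (Suc n) * real (Suc n) ^ s n * over_fact (M \<mu>) (s n) < (w n (s n))\<^sup>2"
      and s: "strict_mono s"
      by (auto simp: strict_mono_Suc_iff)
    \<comment> \<open>As \<open>s\<close> is injective, \<open>inv_into UNIV s\<close> recovers
      \<open>n\<close> from \<open>j = s n\<close>.\<close>
    define F where "F = Abs_fps (\<lambda>j. if j \<in> range s then
        complex_of_real (w (inv_into UNIV s j) j / sqrt (real (Suc (inv_into UNIV s j))) ^ j) else 0)"
    have "inj s"
      using s by (rule strict_mono_imp_inj_on)
    then have F: "fps_nth F (s n) = complex_of_real (w n (s n) / sqrt (real (Suc n)) ^ s n)" for n
      by (simp add: F_def)
    have wpos: "0 < w n j" for n j
      by (simp add: w_def over_fact_pos[OF M])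
    have "norm (fps_nth F (s n)) = w n (s n) / sqrt (real (Suc n)) ^ s n" for n
      unfolding F norm_of_real using wpos[of n "s n"] by simp
    then have "F \<in> fps_beurling M"
      unfolding w_def by (rule lacunary_mem_beurling[OF M s]) (auto simp: F_def)
    then have "fps_hadamard F F \<in> fps_beurling M"
      using L by (simp add: closed_under_def)
    \<comment> \<open>Rate 1 leaves a plain constant multiple of the weight at \<mu>, the index
      where the growth condition fails.\<close>
    then have "\<exists>C>0. \<forall>j. norm (fps_nth (fps_hadamard F F) j) \<le> C * 1 ^ j * over_fact (M \<mu>) j"
      unfolding mem_fps_beurling_iff[OF M] using \<mu> zero_less_one by blast
    then obtain C where
      C: "\<And>j. norm (fps_nth (fps_hadamard F F) j) \<le> C * over_fact (M \<mu>) j"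
      by auto
    obtain n where n: "C < real n"
      using reals_Archimedean2 by blast
    have p: "0 < real (Suc n) ^ s n"
      by simp
    have "norm (fps_nth (fps_hadamard F F) (s n)) = (w n (s n) / sqrt (real (Suc n)) ^ s n)\<^sup>2"
      by (simp only: fps_hadamard_def fps_nth_Abs_fps F norm_mult norm_of_real abs_mult_self_eq power2_eq_square)
    also have "\<dots> = (w n (s n))\<^sup>2 / real (Suc n) ^ s n"
      by (simp add: power_divide power_mult[symmetric] mult.commute[of "s n"] del: of_nat_Suc)
        (simp add: power_mult)
    \<comment> \<open>Squaring has turned the rate into 1/(n+1), which cancels the geometric factor
      in \<open>big\<close> exactly; the remaining factor n+1 exceeds any fixed \<open>C\<close> for
      large \<open>n\<close>.\<close>
    also have "\<dots> > real (Suc n) * over_fact (M \<mu>) (s n)"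
      using big[of n] p by (simp add: pos_less_divide_eq mult_ac del: of_nat_Suc)
    finally have "real (Suc n) * over_fact (M \<mu>) (s n) < C * over_fact (M \<mu>) (s n)"
      using C[of "s n"] by linarith
    then show False
      using n over_fact_pos[OF M \<mu>, of "s n"] by simp
  qed
next
  assume R: ?R
  show ?L
    unfolding closed_under_def
  proof (intro ballI)
    fix F G assume FG: "F \<in> fps_beurling M" "G \<in> fps_beurling M"
    show "fps_hadamard F G \<in> fps_beurling M"
      unfolding mem_fps_beurling_iff[OF M]
    proof (intro allI impI)
      fix \<mu> h :: real assume pos: "0 < \<mu>" "0 < h"
      obtain \<kappa> C k where \<kappa>: "0 < \<kappa>" "0 < C" "0 < k"
        and sq: "\<And>j. (over_fact (M \<kappa>) j)\<^sup>2 \<le> C * k ^ j * over_fact (M \<mu>) j"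
        using R pos(1) by blast
      \<comment> \<open>The target rate \<open>h\<close> is prescribed, but the factors satisfy
        bounds at every rate; this one is solved from g * g * k = h, with \<open>k\<close> the loss
        in the growth condition.\<close>
      define g where "g = sqrt (h / k)"
      have g: "0 < g" "g * g * k = h"
        using pos \<kappa> by (simp_all add: g_def)
      obtain A B where AB: "0 < A" "0 < B"
        and F: "\<And>j. norm (fps_nth F j) \<le> A * g ^ j * over_fact (M \<kappa>) j"
        and G: "\<And>j. norm (fps_nth G j) \<le> B * g ^ j * over_fact (M \<kappa>) j"
        using FG \<kappa>(1) g(1) unfolding mem_fps_beurling_iff[OF M] by meson
      have "norm (fps_nth (fps_hadamard F G) j) \<le> (A * B * C) * h ^ j * over_fact (M \<mu>) j" for j
        using norm_mult_le_weighted_square[OF F G sq AB g(1) g(1) over_fact_pos[OF M \<kappa>(1)]]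
        by (simp add: fps_hadamard_def g(2))
      moreover have "0 < A * B * C"
        using AB \<kappa> by simp
      ultimately show "\<exists>C>0. \<forall>j. norm (fps_nth (fps_hadamard F G) j) \<le> C * h ^ j * over_fact (M \<mu>) j"
        by blast
    qed
  qed
qed

section \<open>Ring structure of the Beurling space\<close>

lemma comm_group_fps_beurling:
  assumes M: "standard_log_convex M"
  shows "comm_group \<lparr>carrier = fps_beurling M, monoid.mult = (+), one = 0\<rparr>"
proof -
  have add: "F + G \<in> fps_beurling M" if FG: "F \<in> fps_beurling M" "G \<in> fps_beurling M" for F G
    unfolding mem_fps_beurling_iff[OF M]
  proof (intro allI impI)
    fix \<mu> h :: real assume "0 < \<mu>" "0 < h"
    then obtain A B where AB: "0 < A" "0 < B"
      and F: "\<And>j. norm (fps_nth F j) \<le> A * h ^ j * over_fact (M \<mu>) j"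
      and G: "\<And>j. norm (fps_nth G j) \<le> B * h ^ j * over_fact (M \<mu>) j"
      using FG unfolding mem_fps_beurling_iff[OF M] by meson
    have "norm (fps_nth (F + G) j) \<le> (A + B) * h ^ j * over_fact (M \<mu>) j" for j
      using norm_triangle_le[OF add_mono[OF F G]] by (simp add: algebra_simps)
    moreover have "0 < A + B"
      using AB by simp
    ultimately show "\<exists>C>0. \<forall>j. norm (fps_nth (F + G) j) \<le> C * h ^ j * over_fact (M \<mu>) j"
      by blast
  qed
  have uminus: "- F \<in> fps_beurling M" if "F \<in> fps_beurling M" for F
    using that by (simp add: fps_beurling_def)
  have zero: "0 \<in> fps_beurling M"
    by (simp add: fps_beurling_def)
  show ?thesis
  proof (rule comm_groupI)
    fix F assume "F \<in> carrier \<lparr>carrier = fps_beurling M, monoid.mult = (+), one = 0\<rparr>"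
    then show "\<exists>G\<in>carrier \<lparr>carrier = fps_beurling M, monoid.mult = (+), one = 0\<rparr>.
        G \<otimes>\<^bsub>\<lparr>carrier = fps_beurling M, monoid.mult = (+), one = 0\<rparr>\<^esub> F =
        \<one>\<^bsub>\<lparr>carrier = fps_beurling M, monoid.mult = (+), one = 0\<rparr>\<^esub>"
      by (auto intro!: bexI[of _ "- F"] uminus)
  qed (auto simp: add zero algebra_simps)
qed

text \<open>Associativity and distributivity hold coefficientwise in the complex numbers, and the
  additive group structure is always present, so closure under the product is the only ring axiom
  that depends on the weights.\<close>

lemma nonunital_ring_on_hadamard_beurling_iff:
  assumes "standard_log_convex M"
  shows "nonunital_ring_on fps_hadamard (fps_beurling M) \<longleftrightarrow>
    closed_under fps_hadamard (fps_beurling M)"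
  using comm_group_fps_beurling[OF assms]
  by (auto simp: nonunital_ring_on_def fps_hadamard_def fps_eq_iff algebra_simps)

theorem proposition4p7:
  fixes M :: "real \<Rightarrow> nat \<Rightarrow> real"
  assumes "standard_log_convex M"
  shows
    "(closed_under fps_hadamard (fps_roumieu M) \<longleftrightarrow>
        (\<forall>\<mu>>0. \<exists>\<kappa>>0. \<exists>C>0. \<exists>h>0. \<forall>j.
           (over_fact (M \<mu>) j)\<^sup>2 \<le> C * h ^ j * over_fact (M \<kappa>) j)) \<and>
     (nonunital_ring_on fps_hadamard (fps_beurling M) \<longleftrightarrow>
        (\<forall>\<mu>>0. \<exists>\<kappa>>0. \<exists>C>0. \<exists>h>0. \<forall>j.
           (over_fact (M \<kappa>) j)\<^sup>2 \<le> C * h ^ j * over_fact (M \<mu>) j)) \<and>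
     (closed_under fps_hadamard (fps_beurling M) \<longleftrightarrow>
        (\<forall>\<mu>>0. \<exists>\<kappa>>0. \<exists>C>0. \<exists>h>0. \<forall>j.
           (over_fact (M \<kappa>) j)\<^sup>2 \<le> C * h ^ j * over_fact (M \<mu>) j))"
  unfolding nonunital_ring_on_hadamard_beurling_iff[OF assms]
  using closed_under_hadamard_roumieu_iff[OF assms] closed_under_hadamard_beurling_iff[OF assms]
  by blast

end
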